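(* Let $n\ge2$ be an integer. The Wiener index of $P_n$ is $$W(P_n)=\begin{cases}\frac{25}{4}n^3+9n^2, & n\text{ even},\\ \frac{25}{4}n^3+9n^2-\frac n4, & n\text{ odd},\end{cases}$$ and the Wiener index of $P'_n$ is $$W(P'_n)=\begin{cases}\frac{25}{4}n^3+9n^2-2n, & n\text{ even},\\ \frac{25}{4}n^3+9n^2-\frac{9n}4, & n\text{ odd}.\end{cases}$$
   Context: For $n\ge2$, the linear pentagonal cylinder graph $P_n$ is the simple graph on the $5n$ vertices $\tilde1,\dots,\tilde n$, $1,\dots,2n$, $1',\dots,(2n)'$ with edges: $\{i,i+1\}$ and $\{i',(i+1)'\}$ for $1\le i\le 2n-1$; $\{2n,1\}$ and $\{(2n)',1'\}$; $\{2k-1,(2k-1)'\}$ for $1\le k\le n$; $\{2k,\tilde k\}$ and $\{\tilde k,(2k)'\}$ for $1\le k\le n$. The pentagonal M\"obius chain graph $P'_n$ has the same vertices and edges except that $\{2n,1\}$ and $\{(2n)',1'\}$ are replaced by $\{2n,1'\}$ and $\{(2n)',1\}$. The Wiener index of a connected graph $G$ is $W(G)=\sum_{i<j}d_{ij}$ (sum over unordered pairs of distinct vertices), where $d_{ij}$ is the length of a shortest path between $i$ and $j$. *)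

theory Defs
  imports "Graph_Theory.Graph_Theory"
begin

text \<open>
  Simple graphs are symmetric loop-free digraphs without parallel arcs (locale \<open>pair_graph\<close>);
  the two arcs \<open>(u, v)\<close> and \<open>(v, u)\<close> together represent the edge \<open>{u, v}\<close>.
\<close>

definition graph_of :: "'a set \<Rightarrow> 'a set set \<Rightarrow> 'a pair_pre_digraph" where
  "graph_of V E = \<lparr> pverts = V, parcs = {(u, v). {u, v} \<in> E} \<rparr>"

text \<open>
  Every arc has length 1. The distance is an extended real, equal to \<open>\<infinity>\<close> exactly when there is
  no walk, so a finite Wiener index includes connectedness of the graph.
\<close>

definition graph_dist :: "'a pair_pre_digraph \<Rightarrow> 'a \<Rightarrow> 'a \<Rightarrow> ereal" where
  "graph_dist G u v = wf_digraph.\<mu> (with_proj G) (\<lambda>_. 1) u v"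

text \<open>
  The sum ranges over the two-element sets of vertices. The infimum only serves to read off the
  common value of \<open>graph_dist G u v\<close> and \<open>graph_dist G v u\<close> for \<open>e = {u, v}\<close>; see
  \<open>graph_dist_unordered\<close> below.
\<close>

definition wiener_index :: "'a pair_pre_digraph \<Rightarrow> ereal" where
  "wiener_index G =
    (\<Sum>e | e \<subseteq> pverts G \<and> card e = 2. Inf {graph_dist G u v | u v. e = {u, v}})"

lemma graph_dist_le_sym:
  assumes "pair_graph G"
  shows "graph_dist G v u \<le> graph_dist G u v"
proof -
  interpret pair_graph G by fact
  have rev: "\<exists>q. awalk v q u \<and> length q = length p" if "awalk u p v" for p
    using that
  proof (induction p arbitrary: u)
    case Nil
    then show ?case by (auto simp: awalk_Nil_iff)
  next
    case (Cons e p)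
    then have e: "e \<in> parcs G" "u = fst e" and w: "awalk (snd e) p v"
      by (auto simp: awalk_Cons_iff)
    from Cons.IH[OF w] obtain q where q: "awalk v q (snd e)" "length q = length p" by blast
    have "(snd e, fst e) \<in> parcs G"
      using e(1) pair_sym_arcs unfolding symmetric_def sym_def by simp
    then have "awalk (snd e) [(snd e, fst e)] u"
      using e by (auto simp: awalk_Cons_iff awalk_Nil_iff wellformed')
    then have "awalk v (q @ [(snd e, fst e)]) u"
      using q(1) by (auto intro: awalk_appendI)
    then show ?case using q(2) by (intro exI[of _ "q @ [(snd e, fst e)]"]) auto
  qed
  have cost: "awalk_cost (\<lambda>_. 1) p = real (length p)" for p :: "('a \<times> 'a) list"
    by (induction p) auto
  show ?thesis
    unfolding graph_dist_def \<mu>_def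
  proof (rule INF_mono)
    fix p assume "p \<in> {p. awalk u p v}"
    then obtain q where "awalk v q u" "length q = length p" using rev by blast
    then show "\<exists>q\<in>{p. awalk v p u}. ereal (awalk_cost (\<lambda>_. 1) q) \<le> ereal (awalk_cost (\<lambda>_. 1) p)"
      by (intro bexI[of _ q]) (simp_all add: cost)
  qed
qed

lemma graph_dist_unordered:
  assumes "pair_graph G"
  shows "Inf {graph_dist G a b | a b. {u, v} = {a, b}} = graph_dist G u v"
proof -
  have "graph_dist G v u = graph_dist G u v"
    using graph_dist_le_sym[OF assms] by (intro antisym)
  then have "{graph_dist G a b | a b. {u, v} = {a, b}} = {graph_dist G u v}"
    by (auto simp: doubleton_eq_iff)
  then show ?thesis by simp
qed

text \<open>\<open>Tilde k\<close>, \<open>Plain i\<close> and \<open>Primed i\<close> stand for the vertices $\tilde k$, $i$ and $i'$.\<close>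

datatype vertex = Tilde nat | Plain nat | Primed nat

definition pentagonal_verts :: "nat \<Rightarrow> vertex set" where
  "pentagonal_verts n = Tilde ` {1..n} \<union> Plain ` {1..2 * n} \<union> Primed ` {1..2 * n}"

definition pentagonal_common_edges :: "nat \<Rightarrow> vertex set set" where
  "pentagonal_common_edges n =
      {{Plain i, Plain (i + 1)} | i. 1 \<le> i \<and> i \<le> 2 * n - 1}
    \<union> {{Primed i, Primed (i + 1)} | i. 1 \<le> i \<and> i \<le> 2 * n - 1}
    \<union> {{Plain (2 * k - 1), Primed (2 * k - 1)} | k. 1 \<le> k \<and> k \<le> n}
    \<union> {{Plain (2 * k), Tilde k} | k. 1 \<le> k \<and> k \<le> n}
    \<union> {{Tilde k, Primed (2 * k)} | k. 1 \<le> k \<and> k \<le> n}"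

definition pentagonal_cylinder :: "nat \<Rightarrow> vertex pair_pre_digraph" where
  "pentagonal_cylinder n = graph_of (pentagonal_verts n)
    (pentagonal_common_edges n \<union> {{Plain (2 * n), Plain 1}, {Primed (2 * n), Primed 1}})"

definition pentagonal_moebius :: "nat \<Rightarrow> vertex pair_pre_digraph" where
  "pentagonal_moebius n = graph_of (pentagonal_verts n)
    (pentagonal_common_edges n \<union> {{Plain (2 * n), Primed 1}, {Primed (2 * n), Plain 1}})"

lemma pair_graph_graph_of:
  assumes "finite V" and "\<And>e. e \<in> E \<Longrightarrow> e \<subseteq> V \<and> card e = 2"
  shows "pair_graph (graph_of V E)"
proof -
  have arc: "u \<in> V \<and> v \<in> V \<and> u \<noteq> v" if "(u, v) \<in> parcs (graph_of V E)" for u v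
    using assms(2)[of "{u, v}"] that by (auto simp: graph_of_def)
  then have sub: "parcs (graph_of V E) \<subseteq> V \<times> V" by auto
  have verts: "pverts (graph_of V E) = V" by (simp add: graph_of_def)
  show ?thesis
  proof
    show "finite (pverts (graph_of V E))" using verts assms(1) by simp
    show "finite (parcs (graph_of V E))"
      using sub assms(1) by (meson finite_SigmaI finite_subset)
    show "symmetric (with_proj (graph_of V E))"
      by (simp add: symmetric_def sym_def graph_of_def insert_commute)
    fix e assume "e \<in> parcs (graph_of V E)"
    then have *: "fst e \<in> V \<and> snd e \<in> V \<and> fst e \<noteq> snd e"
      using arc[of "fst e" "snd e"] by simp
    show "fst e \<in> pverts (graph_of V E)" "snd e \<in> pverts (graph_of V E)" "fst e \<noteq> snd e"
      using * verts by simp_all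
  qed
qed

lemma card_pentagonal_verts: "card (pentagonal_verts n) = 5 * n"
proof -
  have "card (pentagonal_verts n) =
      card (Tilde ` {1..n}) + card (Plain ` {1..2 * n}) + card (Primed ` {1..2 * n})"
    unfolding pentagonal_verts_def
    by (subst card_Un_disjoint; (subst card_Un_disjoint)?) auto
  then show ?thesis by (simp add: card_image inj_on_def)
qed

lemma pentagonal_common_edges_wf:
  assumes "e \<in> pentagonal_common_edges n"
  shows "e \<subseteq> pentagonal_verts n \<and> card e = 2"
  using assms unfolding pentagonal_common_edges_def
  by (elim UnE) (auto simp: pentagonal_verts_def image_iff)

lemma pair_graph_pentagonal_cylinder:
  assumes "n \<ge> 2"
  shows "pair_graph (pentagonal_cylinder n)"
  unfolding pentagonal_cylinder_def
proof (rule pair_graph_graph_of)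
  fix e assume "e \<in> pentagonal_common_edges n \<union>
    {{Plain (2 * n), Plain 1}, {Primed (2 * n), Primed 1}}"
  then show "e \<subseteq> pentagonal_verts n \<and> card e = 2"
  proof
    assume "e \<in> {{Plain (2 * n), Plain 1}, {Primed (2 * n), Primed 1}}"
    then show ?thesis using assms by (auto simp: pentagonal_verts_def)
  qed (rule pentagonal_common_edges_wf)
qed (simp add: pentagonal_verts_def)

lemma pair_graph_pentagonal_moebius:
  assumes "n \<ge> 2"
  shows "pair_graph (pentagonal_moebius n)"
  unfolding pentagonal_moebius_def
proof (rule pair_graph_graph_of)
  fix e assume "e \<in> pentagonal_common_edges n \<union>
    {{Plain (2 * n), Primed 1}, {Primed (2 * n), Plain 1}}"
  then show "e \<subseteq> pentagonal_verts n \<and> card e = 2"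
  proof
    assume "e \<in> {{Plain (2 * n), Primed 1}, {Primed (2 * n), Plain 1}}"
    then show ?thesis using assms by (auto simp: pentagonal_verts_def)
  qed (rule pentagonal_common_edges_wf)
qed (simp add: pentagonal_verts_def)

end

theory Submission
  imports Defs
begin

text \<open>
  Both graphs are closed ladders. A column \<open>i\<close> in $1,\dots,2n$ carries the vertices $i$ and $i'$,
  joined by an edge in odd columns and by a path of length two through $\tilde k$ in column $2k$;
  consecutive columns are joined strand by strand, and the seam between columns $2n$ and $1$ either
  keeps the two strands (cylinder) or exchanges them (Moebius chain). A Boolean \<open>m\<close>, true for the
  Moebius chain, lets one argument serve both.

  Two strand vertices, that is $i$ or $i'$ and $j$ or $j'$, in different columns at \<open>gap\<close> $t$ are
  joined by a direct route and by one around the seam. Both meet an odd column, so a change of strand costs one extra step on either route. The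
  direct route changes strand iff the end points lie on different strands, the other one iff this
  holds with the seam taken into account; hence the formula \<open>route_dist\<close>. From a vertex $\tilde k$
  one step leads to either strand, so only the cyclic distance of the columns matters. That these
  values are the graph distances follows from two local facts: they change by at most one along
  every edge (\<open>pentagonal_adj_near\<close>), and from every vertex other than the target some edge
  decreases them (\<open>pentagonal_dist_descent\<close>).

  For the Wiener index, add the distances from a strand vertex to the two strand vertices of
  another column at cyclic distance $c$: the sum is $2c + 1$ in both graphs, with one exception. In the
  Moebius chain, for the opposite column ($t = n$), one of the two routes needs no change of strand
  whichever target is chosen, and the sum is $2n$ instead of $2c + 1 = 2n + 1$
  (\<open>route_dist_strands\<close>). Each of the $4n$ strand vertices loses one such unit, and every
  pair is counted from both of its ends, so the Moebius index is smaller by $2n$. The remaining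
  sums only need that the distances from a point to all points of an $N$-cycle add up to
  $\lfloor N^2/4 \rfloor$ (\<open>sum_cyclic_dist\<close>), used for $N = 2n$ and, for pairs of vertices
  $\tilde k$, $\tilde l$, for $N = n$; the latter is where the parity of $n$ enters.
\<close>

section \<open>Graph distances from a potential and the Wiener index as a double sum\<close>

text \<open>
  An arc changes \<open>f\<close> by at most one, so a walk ending in the zero \<open>u\<close> of \<open>f\<close> is at least as long as
  \<open>f\<close> at its start; following arcs that decrease \<open>f\<close> gives a walk that attains this bound.
\<close>

lemma graph_dist_eq_potential:
  fixes f :: "'a \<Rightarrow> nat"
  assumes "pair_graph G" and u: "u \<in> pverts G" and v: "v \<in> pverts G"
    and zero: "f u = 0"
    and lip: "\<And>x y. (x, y) \<in> parcs G \<Longrightarrow> f x \<le> f y + 1"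
    and descent: "\<And>x. x \<in> pverts G \<Longrightarrow> x \<noteq> u \<Longrightarrow> \<exists>y. (x, y) \<in> parcs G \<and> f y < f x"
  shows "graph_dist G v u = ereal (real (f v))"
proof -
  interpret pair_graph G by fact
  have cost: "awalk_cost (\<lambda>_. 1) p = real (length p)" for p :: "('a \<times> 'a) list"
    by (induction p) auto
  have lower: "f x \<le> length p" if "awalk x p u" for x p
    using that
  proof (induction p arbitrary: x)
    case Nil
    then show ?case using zero by (auto simp: awalk_Nil_iff)
  next
    case (Cons e p)
    then have "(x, snd e) \<in> parcs G" "awalk (snd e) p u" by (auto simp: awalk_Cons_iff)
    then show ?case using Cons.IH lip by fastforce
  qed
  have upper: "\<exists>p. awalk x p u \<and> length p \<le> f x" if "x \<in> pverts G" for x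
    using that
  proof (induction "f x" arbitrary: x rule: less_induct)
    case less
    show ?case
    proof (cases "x = u")
      case True
      then show ?thesis using u by (intro exI[of _ "[]"]) (simp add: awalk_Nil_iff)
    next
      case False
      then obtain y where y: "(x, y) \<in> parcs G" "f y < f x"
        using descent less.prems by blast
      moreover have "y \<in> pverts G" using y(1) wellformed' by fastforce
      ultimately obtain p where "awalk y p u" "length p \<le> f y" using less.hyps by blast
      then show ?thesis
        using y by (intro exI[of _ "(x, y) # p"]) (auto simp: awalk_Cons_iff)
    qed
  qed
  obtain p where p: "awalk v p u" "length p \<le> f v" using upper v by blast
  show ?thesis
    unfolding graph_dist_def \<mu>_def
  proof (rule antisym)
    show "(INF p\<in>{p. awalk v p u}. ereal (awalk_cost (\<lambda>_. 1) p)) \<le> ereal (real (f v))"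
      using p by (intro INF_lower2[of p]) (auto simp: cost)
    show "ereal (real (f v)) \<le> (INF p\<in>{p. awalk v p u}. ereal (awalk_cost (\<lambda>_. 1) p))"
      using lower by (intro INF_greatest) (auto simp: cost)
  qed
qed

text \<open>
  Every two-element set \<open>{a, b}\<close> is hit by exactly the two ordered pairs \<open>(a, b)\<close> and \<open>(b, a)\<close>.
\<close>

lemma sum_doubletons:
  fixes g :: "'a \<Rightarrow> 'a \<Rightarrow> real"
  assumes fin: "finite V" and sym: "\<And>u v. u \<in> V \<Longrightarrow> v \<in> V \<Longrightarrow> g u v = g v u"
    and diag: "\<And>u. u \<in> V \<Longrightarrow> g u u = 0"
    and h: "\<And>u v. u \<in> V \<Longrightarrow> v \<in> V \<Longrightarrow> u \<noteq> v \<Longrightarrow> h {u, v} = g u v"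
  shows "(\<Sum>e | e \<subseteq> V \<and> card e = 2. h e) = (\<Sum>u\<in>V. \<Sum>v\<in>V. g u v) / 2"
proof -
  let ?E = "{e. e \<subseteq> V \<and> card e = 2}" and ?D = "{(u, v) \<in> V \<times> V. u \<noteq> v}"
  have finE: "finite ?E" by (rule finite_subset[of _ "Pow V"]) (auto simp: fin)
  have finD: "finite ?D" by (rule finite_subset[of _ "V \<times> V"]) (auto simp: fin)
  have "(\<Sum>u\<in>V. \<Sum>v\<in>V. g u v) = (\<Sum>(u, v)\<in>V \<times> V. g u v)"
    by (simp add: sum.cartesian_product)
  also have "\<dots> = (\<Sum>(u, v)\<in>?D. g u v)"
    by (rule sum.mono_neutral_right) (auto simp: fin diag)
  also have "\<dots> = (\<Sum>e\<in>?E. \<Sum>(u, v) | (u, v) \<in> ?D \<and> {u, v} = e. g u v)"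
  proof -
    have "(\<lambda>(u, v). {u, v}) ` ?D \<subseteq> ?E" by auto
    from sum.group[OF finD finE this, of "\<lambda>(u, v). g u v"] show ?thesis
      by (simp add: case_prod_unfold)
  qed
  also have "\<dots> = (\<Sum>e\<in>?E. 2 * h e)"
  proof (rule sum.cong[OF refl])
    fix e assume "e \<in> ?E"
    then obtain a b where ab: "e = {a, b}" "a \<noteq> b" "a \<in> V" "b \<in> V"
      by (auto simp: card_2_iff)
    then have "{(u, v). (u, v) \<in> ?D \<and> {u, v} = e} = {(a, b), (b, a)}"
      by (auto simp: doubleton_eq_iff)
    then have "(\<Sum>(u, v) | (u, v) \<in> ?D \<and> {u, v} = e. g u v) = g a b + g b a"
      using ab by simp
    then show "(\<Sum>(u, v) | (u, v) \<in> ?D \<and> {u, v} = e. g u v) = 2 * h e"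
      using ab sym h by simp
  qed
  finally show ?thesis by (simp add: sum_distrib_left[symmetric])
qed

text \<open>
  Reduces the Wiener index to real arithmetic: all distances are finite here, so the extended reals
  can be left before the terms of the sum are regrouped.
\<close>

lemma wiener_index_eq_half_sum:
  fixes d :: "'a \<Rightarrow> 'a \<Rightarrow> nat"
  assumes G: "pair_graph G"
    and d: "\<And>u v. u \<in> pverts G \<Longrightarrow> v \<in> pverts G \<Longrightarrow> graph_dist G v u = ereal (real (d u v))"
    and diag: "\<And>u. u \<in> pverts G \<Longrightarrow> d u u = 0"
  shows "wiener_index G =
    ereal ((\<Sum>u\<in>pverts G. \<Sum>v\<in>pverts G. real (d u v)) / 2)"
proof -
  interpret pair_graph G by fact
  let ?V = "pverts G"
  let ?E = "{e. e \<subseteq> ?V \<and> card e = 2}"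
  define h where "h e = Inf {graph_dist G u v | u v. e = {u, v}}" for e
  have hd: "h {u, v} = ereal (real (d u v))" if "u \<in> ?V" "v \<in> ?V" for u v
    using graph_dist_unordered[OF G, of v u] d that by (simp add: h_def insert_commute)
  have sym: "d u v = d v u" if "u \<in> ?V" "v \<in> ?V" for u v
    using hd[OF that] hd[OF that(2,1)] by (simp add: insert_commute)
  have "wiener_index G = (\<Sum>e\<in>?E. ereal (real_of_ereal (h e)))"
    unfolding wiener_index_def h_def[symmetric]
    by (rule sum.cong) (auto simp: card_2_iff hd)
  also have "\<dots> = ereal (\<Sum>e\<in>?E. real_of_ereal (h e))" by simp
  also have "(\<Sum>e\<in>?E. real_of_ereal (h e)) = (\<Sum>u\<in>?V. \<Sum>v\<in>?V. real (d u v)) / 2"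
    using sym pair_finite_verts by (intro sum_doubletons) (auto simp: hd diag)
  finally show ?thesis .
qed

section \<open>Gaps between columns and distances on a cycle\<close>

definition gap :: "nat \<Rightarrow> nat \<Rightarrow> nat" where
  "gap i j = (i - j) + (j - i)"

lemma gap_self [simp]: "gap i i = 0"
  by (simp add: gap_def)

lemma gap_eq_0 [simp]: "gap i j = 0 \<longleftrightarrow> i = j"
  by (auto simp: gap_def)

lemma gap_commute: "gap i j = gap j i"
  by (simp add: gap_def)

lemma gap_double: "gap (2 * i) (2 * j) = 2 * gap i j"
  by (simp add: gap_def)

lemma gap_Suc_self [simp]: "gap i (Suc i) = 1" "gap (Suc i) i = 1"
  by (simp_all add: gap_def)

lemma gap_step: "gap i (Suc j) = Suc (gap i j) \<or> gap i j = Suc (gap i (Suc j))"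
  unfolding gap_def by linarith

lemma gap_ends:
  assumes "1 \<le> i" "i \<le> N"
  shows "gap i 1 = i - 1" "gap i N = N - i"
  using assms by (auto simp: gap_def)

lemma gap_less:
  assumes "1 \<le> i" "i \<le> N" "1 \<le> j" "j \<le> N"
  shows "gap i j < N"
  using assms by (auto simp: gap_def)

lemma gap_toward:
  assumes "1 \<le> i" "i \<le> N" "1 \<le> j" "j \<le> N" "i \<noteq> j"
  obtains j' where "1 \<le> j'" "j' \<le> N" "j' = Suc j \<or> j = Suc j'" "gap i j = Suc (gap i j')"
proof (cases "i < j")
  case True
  then show ?thesis using assms by (intro that[of "j - 1"]) (auto simp: gap_def)
next
  case False
  then show ?thesis using assms by (intro that[of "j + 1"]) (auto simp: gap_def)
qed

text \<open>
  A step away from column \<open>i\<close> is possible unless \<open>j\<close> is an end of the ladder; there the seam leads to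
  the other end \<open>j'\<close>, and \<open>i\<close> splits the $N - 1$ steps between the two ends.
\<close>

lemma gap_away:
  assumes "1 \<le> i" "i \<le> N" "1 \<le> j" "j \<le> N" "i \<noteq> j"
  obtains (inside) j' where "1 \<le> j'" "j' \<le> N" "j' = Suc j \<or> j = Suc j'" "gap i j' = Suc (gap i j)"
  | (seam) j' where "j = N \<and> j' = 1 \<or> j = 1 \<and> j' = N" "gap i j + gap i j' = N - 1"
proof (cases "i < j")
  case True
  show ?thesis
  proof (cases "j = N")
    case True
    then show ?thesis using assms by (intro seam[of 1]) (auto simp: gap_def)
  next
    case False
    then show ?thesis using assms True by (intro inside[of "j + 1"]) (auto simp: gap_def)
  qed
next
  case False
  show ?thesis
  proof (cases "j = 1")
    case True
    then show ?thesis using assms by (intro seam[of N]) (auto simp: gap_def)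
  next
    case False
    then show ?thesis using assms \<open>\<not> i < j\<close> by (intro inside[of "j - 1"]) (auto simp: gap_def)
  qed
qed

definition cyclic_dist :: "nat \<Rightarrow> nat \<Rightarrow> nat \<Rightarrow> nat" where
  "cyclic_dist N i j = min (gap i j) (N - gap i j)"

lemma cyclic_dist_commute: "cyclic_dist N i j = cyclic_dist N j i"
  by (simp add: cyclic_dist_def gap_commute)

lemma cyclic_dist_double: "cyclic_dist (2 * n) (2 * i) (2 * j) = 2 * cyclic_dist n i j"
  by (simp add: cyclic_dist_def gap_double min_mult_distrib_left diff_mult_distrib2)

text \<open>
  The step goes towards \<open>i\<close> if the direct arc is the shorter one, and away from \<open>i\<close>, possibly across
  the seam, otherwise.
\<close>

lemma cyclic_dist_descent:
  assumes "1 \<le> i" "i \<le> N" "1 \<le> j" "j \<le> N" "i \<noteq> j"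
  obtains j' where "1 \<le> j'" "j' \<le> N" "cyclic_dist N i j' < cyclic_dist N i j"
    "j' = Suc j \<or> j = Suc j' \<or> j = N \<and> j' = 1 \<or> j = 1 \<and> j' = N"
proof (cases "gap i j \<le> N - gap i j")
  case True
  obtain j' where "1 \<le> j'" "j' \<le> N" "j' = Suc j \<or> j = Suc j'" "gap i j = Suc (gap i j')"
    using gap_toward assms by metis
  then show ?thesis using True by (intro that[of j']) (auto simp: cyclic_dist_def)
next
  case False
  have "gap i j < N" using gap_less assms by blast
  from assms show ?thesis
  proof (cases rule: gap_away)
    case (inside j')
    then show ?thesis using False \<open>gap i j < N\<close>
      by (intro that[of j']) (auto simp: cyclic_dist_def)
  next
    case (seam j')
    then show ?thesis using False \<open>gap i j < N\<close> assms
      by (intro that[of j']) (auto simp: cyclic_dist_def)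
  qed
qed

text \<open>
  Without its first and last entries, which are $0$ and $1$, the row for $N + 2$ is the row for $N$
  with every entry raised by one.
\<close>

lemma sum_cyclic_first_row: "(\<Sum>t<N. min t (N - t)) = N\<^sup>2 div 4" for N :: nat
proof (induction N rule: induct_nat_012)
  case (ge2 N)
  have "(\<Sum>t<Suc (Suc N). min t (Suc (Suc N) - t)) =
      (\<Sum>t<N. min (Suc t) (Suc N - t)) + (1 :: nat)"
    by (subst sum.lessThan_Suc_shift) simp
  also have "(\<Sum>t<N. min (Suc t) (Suc N - t)) = (\<Sum>t<N. min t (N - t) + 1)"
    by (rule sum.cong) auto
  also have "\<dots> = N\<^sup>2 div 4 + N" using ge2 by (simp only: sum.distrib) simp
  finally show ?case by (simp add: power2_eq_square algebra_simps)
qed auto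

text \<open>
  A rotation by one position turns the row of \<open>Suc i\<close> into the row of \<open>i\<close>: all terms but one are
  shifted, and the first term becomes the last one.
\<close>

lemma sum_cyclic_dist:
  assumes "1 \<le> i" "i \<le> N"
  shows "(\<Sum>j=1..N. cyclic_dist N i j) = N\<^sup>2 div 4"
  using assms
proof (induction i rule: nat_induct_at_least)
  case base
  have "(\<Sum>j=1..N. cyclic_dist N 1 j) = (\<Sum>t<N. cyclic_dist N 1 (Suc t))"
    by (simp add: sum.atLeast1_atMost_eq)
  also have "\<dots> = (\<Sum>t<N. min t (N - t))" by (simp add: cyclic_dist_def gap_def)
  finally show ?case by (simp add: sum_cyclic_first_row)
next
  case (Suc i)
  then obtain M where N: "N = Suc M" by (cases N) auto
  have "(\<Sum>j=1..N. cyclic_dist N (Suc i) j) = (\<Sum>t<Suc M. cyclic_dist N (Suc i) (Suc t))"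
    by (simp add: sum.atLeast1_atMost_eq N)
  also have "\<dots> = cyclic_dist N (Suc i) 1 + (\<Sum>t<M. cyclic_dist N (Suc i) (Suc (Suc t)))"
    by (subst sum.lessThan_Suc_shift) simp
  also have "\<dots> = cyclic_dist N i N + (\<Sum>t<M. cyclic_dist N i (Suc t))"
    using Suc.prems Suc.hyps by (auto simp: cyclic_dist_def gap_def N)
  also have "\<dots> = (\<Sum>t<Suc M. cyclic_dist N i (Suc t))"
    by (simp add: N)
  also have "\<dots> = (\<Sum>j=1..N. cyclic_dist N i j)"
    by (simp add: sum.atLeast1_atMost_eq N)
  finally show ?case using Suc by simp
qed

section \<open>Nearly equal distances\<close>

text \<open>
  The Lipschitz condition for an edge. As it is stable under minima and truncated differences, the
  distance formulas below can be compared term by term.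
\<close>

definition near :: "nat \<Rightarrow> nat \<Rightarrow> bool" where
  "near a b \<longleftrightarrow> a \<le> b + 1 \<and> b \<le> a + 1"

lemma near_Suc [simp]: "near (Suc a) (Suc b) \<longleftrightarrow> near a b"
  by (auto simp: near_def)

lemma near_min: "near a c \<Longrightarrow> near b d \<Longrightarrow> near (min a b) (min c d)"
  by (auto simp: near_def min_def)

lemma near_add_of_bool: "near (a + of_bool p) (a + of_bool q)"
  by (auto simp: near_def)

lemma near_add: "near a b \<Longrightarrow> near (a + c) (b + c)"
  by (auto simp: near_def)

lemma near_diff: "near a b \<Longrightarrow> near (c - a) (c - b)"
  by (auto simp: near_def)

lemma gap_near: "near (gap i j) (gap i (Suc j))"
  using gap_step[of i j] unfolding near_def by linarith

lemma cyclic_dist_near: "near (cyclic_dist N i j) (cyclic_dist N i (Suc j))"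
  unfolding cyclic_dist_def by (intro near_min near_diff gap_near)

lemma cyclic_dist_near_seam:
  assumes "1 \<le> i" "i \<le> N"
  shows "near (cyclic_dist N i N) (cyclic_dist N i 1)"
  using assms unfolding cyclic_dist_def gap_ends[OF assms] by (subst min.commute)
    (intro near_min; auto simp: near_def)

section \<open>Routes between strand vertices\<close>

definition rung_length :: "nat \<Rightarrow> nat" where
  "rung_length i = (if even i then 2 else 1)"

text \<open>
  The distance of strand vertices in columns \<open>i\<close> and \<open>j\<close>, on different strands iff \<open>s\<close> holds. The two
  terms of the minimum belong to the direct route and the route around the seam; crossing a twisted
  seam flips \<open>s\<close>. Vertices of one column on different strands are the exception, since an even
  column offers no single-step crossing.
\<close>

definition route_dist :: "bool \<Rightarrow> nat \<Rightarrow> bool \<Rightarrow> nat \<Rightarrow> nat \<Rightarrow> nat" where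
  "route_dist m n s i j =
     (if i = j \<and> s then rung_length i
      else min (gap i j + of_bool s) (2 * n - gap i j + of_bool (s \<noteq> m)))"

lemma route_dist_same: "route_dist m n s i i = (if s then rung_length i else 0)"
  by (simp add: route_dist_def gap_def)

lemma route_dist_other:
  assumes "i \<noteq> j \<or> \<not> s"
  shows "route_dist m n s i j = min (gap i j + of_bool s) (2 * n - gap i j + of_bool (s \<noteq> m))"
  using assms by (auto simp: route_dist_def)

lemma route_dist_le:
  assumes "i \<noteq> j \<or> \<not> s"
  shows "route_dist m n s i j \<le> gap i j + of_bool s"
    and "route_dist m n s i j \<le> 2 * n - gap i j + of_bool (s \<noteq> m)"
  unfolding route_dist_other[OF assms] by simp_all

text \<open>
  The case distinction isolates the columns in which the exceptional clause of \<open>route_dist\<close> is used;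
  elsewhere both routes change by at most one step. Beside such a column, \<open>n \<ge> 2\<close> makes the route
  around the seam too long to matter.
\<close>

lemma route_dist_near:
  assumes "n \<ge> 2"
  shows "near (route_dist m n s i j) (route_dist m n s i (Suc j))"
proof -
  consider "i = j" | "i = Suc j" | "i \<noteq> j" "i \<noteq> Suc j" by blast
  then show ?thesis
  proof cases
    case 3
    then show ?thesis
      by (simp only: route_dist_other simp_thms) (intro near_min near_add near_diff gap_near)
  qed (use assms in \<open>auto simp: route_dist_same route_dist_other rung_length_def near_def\<close>)
qed

lemma route_dist_near_rung:
  assumes "odd j"
  shows "near (route_dist m n s i j) (route_dist m n (\<not> s) i j)"
proof (cases "i = j")
  case True
  then show ?thesis using assms by (simp add: route_dist_same rung_length_def near_def)
next
  case False
  then show ?thesis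
    by (simp only: route_dist_other simp_thms) (intro near_min near_add_of_bool)
qed

lemma route_dist_near_half_rung:
  assumes "even j"
  shows "near (route_dist m n s i j) (Suc (cyclic_dist (2 * n) i j))"
proof (cases "i = j")
  case True
  then show ?thesis using assms
    by (simp add: route_dist_same rung_length_def cyclic_dist_def gap_def near_def)
next
  case False
  then show ?thesis
    by (simp only: route_dist_other simp_thms cyclic_dist_def min_Suc_Suc[symmetric])
      (intro near_min; simp add: near_def)
qed

text \<open>
  Crossing the seam exchanges the roles of the two routes: the direct route to one end of the ladder
  extends to the route around the seam to the other end.
\<close>

lemma route_dist_near_seam:
  assumes n: "n \<ge> 2" and i: "1 \<le> i" "i \<le> 2 * n"
  shows "near (route_dist m n s i (2 * n)) (route_dist m n (s \<noteq> m) i 1)"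
proof -
  have ss: "((s \<noteq> m) \<noteq> m) = s" by auto
  consider "i = 1" | "i = 2 * n" | "i \<noteq> 1" "i \<noteq> 2 * n" by blast
  then show ?thesis
  proof cases
    case 1
    then have "route_dist m n s i (2 * n) = 1 + of_bool (s \<noteq> m)"
      using n by (simp add: route_dist_other gap_def)
    then show ?thesis using 1 by (auto simp: route_dist_same rung_length_def near_def)
  next
    case 2
    then have "route_dist m n (s \<noteq> m) i 1 = 1 + of_bool s"
      using n by (simp only: route_dist_other ss) (simp add: route_dist_other gap_def)
    then show ?thesis using 2 by (auto simp: route_dist_same rung_length_def near_def)
  next
    case 3
    have "near (min (2 * n - (2 * n - i) + of_bool (s \<noteq> m)) (2 * n - i + of_bool s))
      (min (i - 1 + of_bool (s \<noteq> m)) (2 * n - (i - 1) + of_bool s))"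
      using i by (intro near_min; auto simp: near_def)
    moreover have "route_dist m n s i (2 * n) =
        min (2 * n - i + of_bool s) (2 * n - (2 * n - i) + of_bool (s \<noteq> m))"
      by (simp only: route_dist_other[OF disjI1[OF 3(2)]] gap_ends(2)[OF i])
    moreover have "route_dist m n (s \<noteq> m) i 1 =
        min (i - 1 + of_bool (s \<noteq> m)) (2 * n - (i - 1) + of_bool s)"
      by (simp only: route_dist_other[OF disjI1[OF 3(1)]] gap_ends(1)[OF i] ss)
    ultimately show ?thesis
      by (subst (asm) min.commute) (simp only:)
  qed
qed

section \<open>The two graphs as ladders with a seam\<close>

text \<open>
  Naming the strand by a Boolean turns exchange of strands into negation and the seam of either
  graph into \<open>b \<noteq> m\<close>.
\<close>

fun strand :: "bool \<Rightarrow> nat \<Rightarrow> vertex" where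
  "strand True i = Plain i"
| "strand False i = Primed i"

lemma strand_eq_iff [simp]:
  "strand b i = strand c j \<longleftrightarrow> b = c \<and> i = j"
  "strand b i \<noteq> Tilde l" "Tilde l \<noteq> strand b i"
  by (cases b; cases c; simp)+

lemma strand_conv:
  "Plain i = strand b j \<longleftrightarrow> b \<and> i = j" "Primed i = strand b j \<longleftrightarrow> \<not> b \<and> i = j"
  "strand b j = Plain i \<longleftrightarrow> b \<and> i = j" "strand b j = Primed i \<longleftrightarrow> \<not> b \<and> i = j"
  by (cases b; auto)+

lemma vertex_cases:
  obtains k where "v = Tilde k" | b i where "v = strand b i"
  by (metis strand.simps vertex.exhaust)

lemma pverts_pentagonal [simp]:
  "pverts (pentagonal_cylinder n) = pentagonal_verts n"
  "pverts (pentagonal_moebius n) = pentagonal_verts n"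
  by (simp_all add: pentagonal_cylinder_def pentagonal_moebius_def graph_of_def)

lemma pentagonal_verts_simps [simp]:
  "Tilde k \<in> pentagonal_verts n \<longleftrightarrow> 1 \<le> k \<and> k \<le> n"
  "strand b i \<in> pentagonal_verts n \<longleftrightarrow> 1 \<le> i \<and> i \<le> 2 * n"
  by (cases b; auto simp: pentagonal_verts_def image_iff)+

abbreviation pentagonal_graph :: "bool \<Rightarrow> nat \<Rightarrow> vertex pair_pre_digraph" where
  "pentagonal_graph m n \<equiv> if m then pentagonal_moebius n else pentagonal_cylinder n"

text \<open>
  Each edge in one orientation only; the graphs have both orientations as arcs.
\<close>

inductive pentagonal_adj :: "bool \<Rightarrow> nat \<Rightarrow> vertex \<Rightarrow> vertex \<Rightarrow> bool" for m n where
  along: "1 \<le> j \<Longrightarrow> j < 2 * n \<Longrightarrow> pentagonal_adj m n (strand b j) (strand b (Suc j))"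
| seam: "pentagonal_adj m n (strand b (2 * n)) (strand (b \<noteq> m) 1)"
| rung: "odd j \<Longrightarrow> j \<le> 2 * n \<Longrightarrow> pentagonal_adj m n (strand b j) (strand (\<not> b) j)"
| half_rung: "1 \<le> l \<Longrightarrow> l \<le> n \<Longrightarrow> pentagonal_adj m n (strand b (2 * l)) (Tilde l)"

lemma pentagonal_adj_edge:
  assumes "pentagonal_adj m n x y"
  shows "(x, y) \<in> parcs (pentagonal_graph m n) \<and> (y, x) \<in> parcs (pentagonal_graph m n)"
  using assms
proof cases
  case (along j b)
  then show ?thesis
    by (cases b) (auto simp: pentagonal_moebius_def pentagonal_cylinder_def graph_of_def
      pentagonal_common_edges_def doubleton_eq_iff)
next
  case (seam b)
  then show ?thesis
    by (cases b) (auto simp: pentagonal_moebius_def pentagonal_cylinder_def graph_of_def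
      doubleton_eq_iff strand_conv)
next
  case (rung j b)
  then show ?thesis
    by (cases b) (auto simp: pentagonal_moebius_def pentagonal_cylinder_def graph_of_def
      pentagonal_common_edges_def doubleton_eq_iff elim!: oddE intro!: exI[of _ "Suc _"])
next
  case (half_rung l b)
  then show ?thesis
    by (cases b) (auto simp: pentagonal_moebius_def pentagonal_cylinder_def graph_of_def
      pentagonal_common_edges_def doubleton_eq_iff)
qed

lemma arc_pentagonal_adj:
  assumes "(x, y) \<in> parcs (pentagonal_graph m n)"
  shows "pentagonal_adj m n x y \<or> pentagonal_adj m n y x"
proof -
  let ?joined = "\<lambda>e. \<exists>p q. e = {p, q} \<and> pentagonal_adj m n p q"
  have joined: "?joined {p, q}" if "pentagonal_adj m n p q" for p q
    using that by blast
  have common: "?joined e" if "e \<in> pentagonal_common_edges n" for e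
    using that unfolding pentagonal_common_edges_def
  proof (elim UnE CollectE exE conjE)
    fix i assume "e = {Plain i, Plain (i + 1)}" "1 \<le> i" "i \<le> 2 * n - 1"
    then show ?thesis using joined[OF along[of i n m True]] by auto
  next
    fix i assume "e = {Primed i, Primed (i + 1)}" "1 \<le> i" "i \<le> 2 * n - 1"
    then show ?thesis using joined[OF along[of i n m False]] by auto
  next
    fix k assume "e = {Plain (2 * k - 1), Primed (2 * k - 1)}" "1 \<le> k" "k \<le> n"
    then show ?thesis using joined[OF rung[of "2 * k - 1" n m True]] by auto
  next
    fix k assume "e = {Plain (2 * k), Tilde k}" "1 \<le> k" "k \<le> n"
    then show ?thesis using joined[OF half_rung[of k n m True]] by auto
  next
    fix k assume "e = {Tilde k, Primed (2 * k)}" "1 \<le> k" "k \<le> n"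
    then show ?thesis using joined[OF half_rung[of k n m False]] by (auto simp: insert_commute)
  qed
  have "?joined {x, y}"
  proof (cases "{x, y} \<in> pentagonal_common_edges n")
    case True
    then show ?thesis by (rule common)
  next
    case False
    then have "{x, y} = {strand True (2 * n), strand (True \<noteq> m) 1} \<or>
        {x, y} = {strand False (2 * n), strand (False \<noteq> m) 1}"
      using assms
      by (cases m) (simp_all add: pentagonal_moebius_def pentagonal_cylinder_def graph_of_def)
    then obtain b where "{x, y} = {strand b (2 * n), strand (b \<noteq> m) 1}" by blast
    then show ?thesis using joined[OF seam[of m n b]] by (simp only:)
  qed
  then show ?thesis by (auto simp: doubleton_eq_iff)
qed

lemma adj_along:
  assumes "1 \<le> j" "j \<le> 2 * n" "1 \<le> j'" "j' \<le> 2 * n" "j' = Suc j \<or> j = Suc j'"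
  shows "pentagonal_adj m n (strand b j) (strand b j') \<or> pentagonal_adj m n (strand b j') (strand b j)"
  using assms along[of j n m b] along[of j' n m b] by auto

text \<open>
  The seam looks the same from both ends because exchanging strands is an involution.
\<close>

lemma adj_seam:
  assumes "j = 2 * n \<and> j' = 1 \<or> j = 1 \<and> j' = 2 * n"
  shows "pentagonal_adj m n (strand b j) (strand (b \<noteq> m) j') \<or>
    pentagonal_adj m n (strand (b \<noteq> m) j') (strand b j)"
  using assms seam[of m n b] seam[of m n "b \<noteq> m"] by (cases m) auto

section \<open>The distance function of the two graphs\<close>

text \<open>
  From $\tilde k$ one step reaches whichever strand of its column suits the remaining route, so the
  distances that involve $\tilde k$ do not depend on the seam. Two distinct such vertices cost one step
  at each end.
\<close>

fun pentagonal_dist :: "bool \<Rightarrow> nat \<Rightarrow> vertex \<Rightarrow> vertex \<Rightarrow> nat" where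
  "pentagonal_dist m n (Plain i) (Plain j) = route_dist m n False i j"
| "pentagonal_dist m n (Primed i) (Primed j) = route_dist m n False i j"
| "pentagonal_dist m n (Plain i) (Primed j) = route_dist m n True i j"
| "pentagonal_dist m n (Primed i) (Plain j) = route_dist m n True i j"
| "pentagonal_dist m n (Tilde k) (Plain j) = cyclic_dist (2 * n) (2 * k) j + 1"
| "pentagonal_dist m n (Tilde k) (Primed j) = cyclic_dist (2 * n) (2 * k) j + 1"
| "pentagonal_dist m n (Plain i) (Tilde l) = cyclic_dist (2 * n) i (2 * l) + 1"
| "pentagonal_dist m n (Primed i) (Tilde l) = cyclic_dist (2 * n) i (2 * l) + 1"
| "pentagonal_dist m n (Tilde k) (Tilde l) =
     (if k = l then 0 else cyclic_dist (2 * n) (2 * k) (2 * l) + 2)"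

lemma pentagonal_dist_strand [simp]:
  "pentagonal_dist m n (strand a i) (strand b j) = route_dist m n (a \<noteq> b) i j"
  "pentagonal_dist m n (Tilde k) (strand b j) = cyclic_dist (2 * n) (2 * k) j + 1"
  "pentagonal_dist m n (strand a i) (Tilde l) = cyclic_dist (2 * n) i (2 * l) + 1"
  by (cases a; cases b; simp)+

lemma pentagonal_dist_self:
  "pentagonal_dist m n u u = 0"
  by (cases u rule: vertex_cases) (simp_all add: route_dist_same)

lemma pentagonal_adj_near:
  assumes "n \<ge> 2" and u: "u \<in> pentagonal_verts n" and adj: "pentagonal_adj m n x y"
  shows "near (pentagonal_dist m n u x) (pentagonal_dist m n u y)"
  using adj
proof cases
  case (along j b)
  then show ?thesis
    using assms cyclic_dist_near route_dist_near by (cases u rule: vertex_cases) auto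
next
  case (seam b)
  have "(a \<noteq> (b \<noteq> m)) = ((a \<noteq> b) \<noteq> m)" for a by auto
  then show ?thesis
    using seam u assms(1) cyclic_dist_near_seam[of "2 * _" "2 * n"] route_dist_near_seam[of n _ m]
    by (cases u rule: vertex_cases) auto
next
  case (rung j b)
  then show ?thesis
    using route_dist_near_rung[of j m n "_ \<noteq> b"]
    by (cases u rule: vertex_cases) (auto simp: near_def)
next
  case (half_rung l b)
  then show ?thesis
    using route_dist_near_half_rung[of "2 * l"]
    by (cases u rule: vertex_cases) (auto simp: near_def cyclic_dist_def gap_def[of "2 * l" "2 * l"])
qed

text \<open>
  A step along a shortest route. The only danger is to arrive in the column of the target on the
  wrong strand when that column is even, where the last crossing costs two steps. A required change
  of strand is therefore made at the first odd column: if \<open>j\<close> is odd, the step is the rung; if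
  \<open>j\<close> is even, the next column is odd, also across the seam since $2n$ is even and $1$ is odd.
\<close>

lemma strand_descent:
  assumes n: "n \<ge> 2" and i: "1 \<le> i" "i \<le> 2 * n" and j: "1 \<le> j" "j \<le> 2 * n" and "i \<noteq> j"
  shows "\<exists>y. (pentagonal_adj m n (strand b j) y \<or> pentagonal_adj m n y (strand b j)) \<and>
    pentagonal_dist m n (strand a i) y < pentagonal_dist m n (strand a i) (strand b j)"
    (is "\<exists>y. ?adj y \<and> ?d y < ?d (strand b j)")
proof -
  define s where "s \<longleftrightarrow> a \<noteq> b"
  define t where "t = gap i j"
  have t: "0 < t" "t < 2 * n"
    using gap_less[OF i j] gap_eq_0[of i j] \<open>i \<noteq> j\<close> by (auto simp: t_def simp del: gap_eq_0)
  have layers: "(a \<noteq> b) = s" "(a \<noteq> (\<not> b)) = (\<not> s)" "(a \<noteq> (b \<noteq> m)) = (s \<noteq> m)"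
    by (auto simp: s_def)
  note d = pentagonal_dist_strand(1) layers
  have dj: "?d (strand b j) = min (t + of_bool s) (2 * n - t + of_bool (s \<noteq> m))"
    unfolding d t_def by (rule route_dist_other) (simp add: \<open>i \<noteq> j\<close>)
  have "?d (strand (\<not> b) j) \<le> t + of_bool (\<not> s)"
    "?d (strand (\<not> b) j) \<le> 2 * n - t + of_bool ((\<not> s) \<noteq> m)"
    unfolding d t_def by (rule route_dist_le; simp add: \<open>i \<noteq> j\<close>)+
  note cross = this
  have rung: "?adj (strand (\<not> b) j)" if "odd j"
    using rung[OF that j(2)] by blast
  show ?thesis
  proof (cases "t + of_bool s \<le> 2 * n - t + of_bool (s \<noteq> m)")
    case direct: True
    \<comment> \<open>The direct route is shortest: cross at once if possible, otherwise move towards \<open>i\<close>.\<close>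
    show ?thesis
    proof (cases "s \<and> odd j")
      case True
      then have "?d (strand (\<not> b) j) < ?d (strand b j)" using cross(1) dj direct by simp
      then show ?thesis using rung True by blast
    next
      case False
      obtain j' where j': "1 \<le> j'" "j' \<le> 2 * n" "j' = Suc j \<or> j = Suc j'" "gap i j = Suc (gap i j')"
        using gap_toward i j \<open>i \<noteq> j\<close> by metis
      have "route_dist m n s i j' < t + of_bool s"
      proof (cases "i = j' \<and> s")
        case True
        then have "odd i" using False j'(3) by auto
        then show ?thesis using True t by (simp add: route_dist_same rung_length_def)
      next
        case False
        then show ?thesis using j'(4) route_dist_le(1)[of i j' s m n] by (simp add: t_def)
      qed
      then have "?d (strand b j') < ?d (strand b j)" using dj direct by (simp only: d)
      then show ?thesis using adj_along[OF j j'(1-3)] by blast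
    qed
  next
    case around: False
    \<comment> \<open>The route around the seam is shortest; along it, \<open>s \<noteq> m\<close> says that a crossing is still due.\<close>
    then have dj: "?d (strand b j) = 2 * n - t + of_bool (s \<noteq> m)" using dj by linarith
    show ?thesis
    proof (cases "s \<noteq> m \<and> odd j")
      case True
      then have "?d (strand (\<not> b) j) < ?d (strand b j)" using cross(2) dj by simp
      then show ?thesis using rung True by blast
    next
      case False
      from i j \<open>i \<noteq> j\<close> show ?thesis
      proof (cases rule: gap_away)
        case (inside j')
        then have "i \<noteq> j'" by auto
        then have "route_dist m n s i j' \<le> 2 * n - Suc t + of_bool (s \<noteq> m)"
          using inside(4) route_dist_le(2)[of i j' s m n] by (simp only: t_def simp_thms)
        then have "?d (strand b j') < ?d (strand b j)"
          using dj t by (simp only: d)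
        then show ?thesis using adj_along[OF j inside(1-3)] by blast
      next
        case (seam j')
        have "route_dist m n (s \<noteq> m) i j' < 2 * n - t + of_bool (s \<noteq> m)"
        proof (cases "i = j' \<and> (s \<noteq> m)")
          case True
          then have "odd i" using False seam(1) by auto
          then show ?thesis using True t by (simp add: route_dist_same rung_length_def)
        next
          case False
          then have "route_dist m n (s \<noteq> m) i j' \<le> gap i j' + of_bool (s \<noteq> m)"
            by (intro route_dist_le) blast
          then show ?thesis using seam(2) t unfolding t_def by linarith
        qed
        then have "?d (strand (b \<noteq> m) j') < ?d (strand b j)" using dj by (simp only: d)
        then show ?thesis using adj_seam[OF seam(1)] by blast
      qed
    qed
  qed
qed

text \<open>
  From a vertex $\tilde l$ towards a strand vertex, the step goes to the strand from which the shorter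
  way round can be taken without a further crossing.
\<close>

lemma pentagonal_dist_descent:
  assumes n: "n \<ge> 2" and u: "u \<in> pentagonal_verts n" and x: "x \<in> pentagonal_verts n" "x \<noteq> u"
  shows "\<exists>y. (pentagonal_adj m n x y \<or> pentagonal_adj m n y x) \<and>
    pentagonal_dist m n u y < pentagonal_dist m n u x" (is "\<exists>y. ?adj y \<and> ?d y < ?d x")
proof (cases x rule: vertex_cases)
  case x': (1 l)
  have adj: "?adj (strand b (2 * l))" for b using x x' half_rung[of l n m b] by simp
  show ?thesis
  proof (cases u rule: vertex_cases)
    case (1 k)
    then have "?d (strand True (2 * l)) < ?d x" using x x' by auto
    then show ?thesis using adj by blast
  next
    case (2 a i)
    have "route_dist m n False i (2 * l) \<le> cyclic_dist (2 * n) i (2 * l) \<or>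
        i \<noteq> 2 * l \<and> route_dist m n True i (2 * l) \<le> cyclic_dist (2 * n) i (2 * l)"
      by (cases m) (auto simp: route_dist_def cyclic_dist_def)
    then have "?d (strand a (2 * l)) < ?d x \<or> ?d (strand (\<not> a) (2 * l)) < ?d x"
      using 2 x' by auto
    then show ?thesis using adj by blast
  qed
next
  case x': (2 b j)
  then have j: "1 \<le> j" "j \<le> 2 * n" using x by auto
  show ?thesis
  proof (cases u rule: vertex_cases)
    case u': (1 k)
    then have k: "1 \<le> 2 * k" "2 * k \<le> 2 * n" using u by auto
    show ?thesis
    proof (cases "j = 2 * k")
      case True
      then show ?thesis using u u' x' half_rung[of k n m b]
        by (intro exI[of _ "Tilde k"]) auto
    next
      case False
      then have "2 * k \<noteq> j" by simp
      with k j obtain j' where j': "1 \<le> j'" "j' \<le> 2 * n"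
        "cyclic_dist (2 * n) (2 * k) j' < cyclic_dist (2 * n) (2 * k) j"
        "j' = Suc j \<or> j = Suc j' \<or> j = 2 * n \<and> j' = 1 \<or> j = 1 \<and> j' = 2 * n"
        by (rule cyclic_dist_descent)
      have "?adj (strand b j') \<or> ?adj (strand (b \<noteq> m) j')"
        using j'(4) adj_along[OF j j'(1,2), of m b] adj_seam[of j n j' m b] unfolding x' by blast
      moreover have "?d (strand c j') < ?d x" for c using j' u' x' by simp
      ultimately show ?thesis by blast
    qed
  next
    case u': (2 a i)
    then have i: "1 \<le> i" "i \<le> 2 * n" using u by auto
    show ?thesis
    proof (cases "i = j")
      case False
      then show ?thesis using strand_descent[OF n i j] u' x' by simp
    next
      case True
      then have ab: "a \<noteq> b" using u' x' x by auto
      show ?thesis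
      proof (cases "odd j")
        case odd: True
        then show ?thesis using rung[of j n m b] j u' x' True ab
          by (intro exI[of _ "strand a j"]) (auto simp: route_dist_def rung_length_def gap_def)
      next
        case False
        then obtain l where "j = 2 * l" by (auto elim: evenE)
        then show ?thesis using half_rung[of l n m b] j u' x' True ab
          by (intro exI[of _ "Tilde l"]) (auto simp: route_dist_def rung_length_def cyclic_dist_def)
      qed
    qed
  qed
qed

text \<open>
  The potential measures the distance to the fixed vertex \<open>u\<close>, which is why \<open>u\<close> is the end point
  here but the first argument of \<open>pentagonal_dist\<close>.
\<close>

lemma graph_dist_pentagonal:
  assumes n: "n \<ge> 2" and u: "u \<in> pentagonal_verts n" and v: "v \<in> pentagonal_verts n"
  shows "graph_dist (pentagonal_graph m n) v u = ereal (real (pentagonal_dist m n u v))"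
proof (rule graph_dist_eq_potential)
  show "pair_graph (pentagonal_graph m n)"
    using n pair_graph_pentagonal_cylinder pair_graph_pentagonal_moebius by simp
  show "u \<in> pverts (pentagonal_graph m n)" "v \<in> pverts (pentagonal_graph m n)"
    using u v by simp_all
  show "pentagonal_dist m n u u = 0" by (rule pentagonal_dist_self)
  show "pentagonal_dist m n u x \<le> pentagonal_dist m n u y + 1"
    if "(x, y) \<in> parcs (pentagonal_graph m n)" for x y
    using arc_pentagonal_adj[OF that] pentagonal_adj_near[OF n u, of m x y]
      pentagonal_adj_near[OF n u, of m y x] by (auto simp: near_def)
  show "\<exists>y. (x, y) \<in> parcs (pentagonal_graph m n) \<and> pentagonal_dist m n u y < pentagonal_dist m n u x"
    if "x \<in> pverts (pentagonal_graph m n)" "x \<noteq> u" for x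
  proof -
    have "x \<in> pentagonal_verts n" using that by (simp split: if_splits)
    then show ?thesis
      using pentagonal_dist_descent[OF n u _ that(2), of m] pentagonal_adj_edge by blast
  qed
qed

section \<open>Summation of the distances\<close>

lemma sum_pentagonal_verts:
  "(\<Sum>v\<in>pentagonal_verts n. f v) =
     (\<Sum>k=1..n. f (Tilde k)) + (\<Sum>i=1..2*n. f (Plain i) + f (Primed i))"
  for f :: "vertex \<Rightarrow> nat"
proof -
  have "(\<Sum>v\<in>pentagonal_verts n. f v) =
    sum f (Tilde ` {1..n}) + sum f (Plain ` {1..2 * n}) + sum f (Primed ` {1..2 * n})"
    unfolding pentagonal_verts_def
    by (subst sum.union_disjoint; (subst sum.union_disjoint)?) auto
  then show ?thesis by (simp add: sum.reindex inj_on_def sum.distrib)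
qed

lemma sum_indicator_even: "(\<Sum>i=1..2*n. if even i then 1 else 0) = (n :: nat)"
  by (induction n) auto

text \<open>
  For distinct columns at gap $t$ and cyclic distance $c$: untwisted, one strand contributes $c$ and
  the other $c + 1$. Twisted, the direct route and the route around the seam favour different
  strands, so for $t < n$ and for $t > n$ the values are still $c$ and $c + 1$, but for $t = n$ both
  strands are reached in $n$ steps.
\<close>

lemma route_dist_strands:
  assumes "1 \<le> i" "i \<le> 2 * n" "1 \<le> j" "j \<le> 2 * n"
  shows "route_dist m n False i j + route_dist m n True i j + of_bool (m \<and> gap i j = n) =
    2 * cyclic_dist (2 * n) i j + 1 + (if i = j \<and> even i then 1 else 0)"
proof (cases "i = j")
  case True
  then show ?thesis using assms by (auto simp: route_dist_def rung_length_def cyclic_dist_def gap_def)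
next
  case False
  then show ?thesis using gap_less[OF assms]
    by (cases m; cases "gap i j = n"; simp add: route_dist_def cyclic_dist_def; linarith?)
qed

lemma sum_antipodal:
  assumes "1 \<le> i" "i \<le> 2 * n"
  shows "(\<Sum>j=1..2*n. of_bool (m \<and> gap i j = n)) = (of_bool m :: nat)"
proof -
  have "{j \<in> {1..2 * n}. gap i j = n} = {if i \<le> n then i + n else i - n}"
    using assms by (auto simp: gap_def split: if_splits)
  then have "card {j \<in> {1..2 * n}. gap i j = n} = 1" by simp
  then show ?thesis by (cases m) (simp_all add: Int_def)
qed

text \<open>
  The term \<open>4 * n * of_bool m\<close> on the left collects the units lost to opposite columns, which avoids
  subtraction of natural numbers.
\<close>

lemma sum_pentagonal_dist:
  "(\<Sum>u\<in>pentagonal_verts n. \<Sum>v\<in>pentagonal_verts n. pentagonal_dist m n u v)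
     + 4 * n * of_bool m =
   12 * n ^ 3 + 18 * n\<^sup>2 + 2 * n * (n\<^sup>2 div 4)"
proof -
  let ?c = "cyclic_dist (2 * n)" and ?d = "pentagonal_dist m n"
  let ?S = "route_dist m n False" and ?X = "route_dist m n True"
  let ?\<delta> = "\<lambda>i j. of_bool (m \<and> gap i j = n)" and ?e = "of_bool m :: nat"
  have c_row: "(\<Sum>j=1..2*n. ?c i j) = n\<^sup>2" if "1 \<le> i" "i \<le> 2 * n" for i
    using sum_cyclic_dist[OF that] by (simp add: power_mult_distrib)
  \<comment> \<open>The 2 stands for the two end steps, which are absent from the vanishing term \<open>l = k\<close>.\<close>
  have TT: "(\<Sum>l=1..n. ?d (Tilde k) (Tilde l)) + 2 = 2 * (n\<^sup>2 div 4) + 2 * n"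
    if k: "k \<in> {1..n}" for k
  proof -
    have "(\<Sum>l=1..n. ?d (Tilde k) (Tilde l)) + 2 =
      (\<Sum>l=1..n. ?d (Tilde k) (Tilde l)) + (\<Sum>l=1..n. if k = l then 2 else 0)"
      using k by simp
    also have "\<dots> = (\<Sum>l=1..n. 2 * cyclic_dist n k l + 2)"
      unfolding sum.distrib[symmetric]
      by (rule sum.cong) (auto simp: cyclic_dist_double, simp add: cyclic_dist_def gap_def)
    also have "\<dots> = 2 * (n\<^sup>2 div 4) + 2 * n"
      using k sum_cyclic_dist[of k n]
      by (simp only: sum.distrib sum_distrib_left[symmetric]) simp
    finally show ?thesis .
  qed
  have TP: "(\<Sum>j=1..2*n. ?c (2 * k) j + 1) = n\<^sup>2 + 2 * n" if "k \<in> {1..n}" for k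
    using that c_row[of "2 * k"] by (simp only: sum.distrib) simp
  \<comment> \<open>The even columns are not a full cycle, so the double sum is evaluated from their side.\<close>
  have PT: "(\<Sum>i=1..2*n. \<Sum>l=1..n. ?c i (2 * l) + 1) = n * (n\<^sup>2 + 2 * n)"
  proof -
    have "(\<Sum>i=1..2*n. \<Sum>l=1..n. ?c i (2 * l) + 1) = (\<Sum>l=1..n. \<Sum>i=1..2*n. ?c (2 * l) i + 1)"
      by (subst sum.swap) (simp add: cyclic_dist_commute)
    also have "\<dots> = (\<Sum>l=1..n. n\<^sup>2 + 2 * n)" by (rule sum.cong[OF refl TP])
    finally show ?thesis by simp
  qed
  have PP: "(\<Sum>j=1..2*n. ?S i j + ?X i j) + ?e = 2 * n\<^sup>2 + 2 * n + (if even i then 1 else 0)"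
    if i: "i \<in> {1..2*n}" for i
  proof -
    have "(\<Sum>j=1..2*n. ?S i j + ?X i j) + ?e = (\<Sum>j=1..2*n. ?S i j + ?X i j + ?\<delta> i j)"
      using i sum_antipodal[of i n m] by (simp add: sum.distrib)
    also have "\<dots> = (\<Sum>j=1..2*n. 2 * ?c i j + 1 + (if i = j then if even i then 1 else 0 else 0))"
      using i by (intro sum.cong) (auto simp: route_dist_strands)
    also have "\<dots> = 2 * n\<^sup>2 + 2 * n + (if even i then 1 else 0)"
      using i c_row[of i] by (simp only: sum.distrib sum_distrib_left[symmetric] sum.delta') simp
    finally show ?thesis .
  qed
  have T: "(\<Sum>k=1..n. \<Sum>v\<in>pentagonal_verts n. ?d (Tilde k) v) + 2 * n =
      n * (2 * (n\<^sup>2 div 4) + 2 * n) + 2 * n * (n\<^sup>2 + 2 * n)"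
  proof -
    have row: "(\<Sum>v\<in>pentagonal_verts n. ?d (Tilde k) v) + 2 =
        2 * (n\<^sup>2 div 4) + 2 * n + 2 * (n\<^sup>2 + 2 * n)" if "k \<in> {1..n}" for k
    proof -
      have "(\<Sum>v\<in>pentagonal_verts n. ?d (Tilde k) v) =
          (\<Sum>l=1..n. ?d (Tilde k) (Tilde l)) + 2 * (\<Sum>j=1..2*n. ?c (2 * k) j + 1)"
        by (simp only: sum_pentagonal_verts pentagonal_dist.simps(5,6) sum.distrib mult_2)
      then show ?thesis unfolding TP[OF that] using TT[OF that] by linarith
    qed
    have "(\<Sum>k=1..n. \<Sum>v\<in>pentagonal_verts n. ?d (Tilde k) v) + 2 * n =
        (\<Sum>k=1..n. (\<Sum>v\<in>pentagonal_verts n. ?d (Tilde k) v) + 2)"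
      by (simp only: sum.distrib) simp
    also have "\<dots> = (\<Sum>k=1..n. 2 * (n\<^sup>2 div 4) + 2 * n + 2 * (n\<^sup>2 + 2 * n))"
      by (rule sum.cong[OF refl row])
    finally show ?thesis by (simp add: algebra_simps)
  qed
  have P: "(\<Sum>i=1..2*n. (\<Sum>v\<in>pentagonal_verts n. ?d (Plain i) v) +
        (\<Sum>v\<in>pentagonal_verts n. ?d (Primed i) v)) + 4 * n * ?e =
      2 * n * (n\<^sup>2 + 2 * n) + 2 * (2 * n * (2 * n\<^sup>2 + 2 * n) + n)"
  proof -
    have row: "(\<Sum>v\<in>pentagonal_verts n. ?d (Plain i) v) + (\<Sum>v\<in>pentagonal_verts n. ?d (Primed i) v) =
        2 * (\<Sum>l=1..n. ?c i (2 * l) + 1) + 2 * (\<Sum>j=1..2*n. ?S i j + ?X i j)" for i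
      by (simp only: sum_pentagonal_verts pentagonal_dist.simps sum.distrib mult_2)
    have "(\<Sum>i=1..2*n. (\<Sum>v\<in>pentagonal_verts n. ?d (Plain i) v) +
        (\<Sum>v\<in>pentagonal_verts n. ?d (Primed i) v)) + 4 * n * ?e =
      2 * (\<Sum>i=1..2*n. \<Sum>l=1..n. ?c i (2 * l) + 1) +
      2 * (\<Sum>i=1..2*n. (\<Sum>j=1..2*n. ?S i j + ?X i j) + ?e)"
      by (simp only: row sum.distrib[of _ _ "{1..2*n}"] sum_distrib_left[symmetric]) simp
    also have "(\<Sum>i=1..2*n. (\<Sum>j=1..2*n. ?S i j + ?X i j) + ?e) =
      (\<Sum>i=1..2*n. 2 * n\<^sup>2 + 2 * n + (if even i then 1 else 0))"
      by (rule sum.cong[OF refl PP])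
    also have "\<dots> = 2 * n * (2 * n\<^sup>2 + 2 * n) + n"
      by (simp only: sum.distrib[of _ _ "{1..2*n}"] sum_indicator_even) (simp add: algebra_simps)
    finally show ?thesis unfolding PT by (simp add: algebra_simps)
  qed
  have "(\<Sum>u\<in>pentagonal_verts n. \<Sum>v\<in>pentagonal_verts n. ?d u v) + 4 * n * ?e + 2 * n =
     (n * (2 * (n\<^sup>2 div 4) + 2 * n) + 2 * n * (n\<^sup>2 + 2 * n)) +
     (2 * n * (n\<^sup>2 + 2 * n) + 2 * (2 * n * (2 * n\<^sup>2 + 2 * n) + n))"
    unfolding T[symmetric] P[symmetric]
    by (simp add: sum_pentagonal_verts[of "\<lambda>u. \<Sum>v\<in>pentagonal_verts n. ?d u v"])
  then show ?thesis by (simp add: algebra_simps power2_eq_square power3_eq_cube)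
qed

section \<open>The Wiener indices\<close>

lemma real_square_div_4:
  "real (n\<^sup>2 div 4) = (if even n then (real n)\<^sup>2 / 4 else ((real n)\<^sup>2 - 1) / 4)"
proof (cases "even n")
  case True
  then obtain k where "n = 2 * k" by (elim evenE)
  then show ?thesis by (simp add: power_mult_distrib)
next
  case False
  then obtain k where n: "n = 2 * k + 1" by (elim oddE)
  then have "n\<^sup>2 = 1 + 4 * (k * (k + 1))" by (simp add: power2_eq_square algebra_simps)
  then have "n\<^sup>2 div 4 = k * (k + 1)" by simp
  then show ?thesis using n by (simp add: power2_eq_square algebra_simps)
qed

lemma wiener_index_pentagonal:
  assumes n: "n \<ge> 2"
  shows "wiener_index (pentagonal_graph m n) =
    ereal (6 * real n ^ 3 + 9 * real n ^ 2 + real n * real (n\<^sup>2 div 4) - 2 * real n * of_bool m)"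
proof -
  let ?V = "pentagonal_verts n"
  have V: "pverts (pentagonal_graph m n) = ?V" by simp
  have "wiener_index (pentagonal_graph m n) =
      ereal ((\<Sum>u\<in>?V. \<Sum>v\<in>?V. real (pentagonal_dist m n u v)) / 2)"
    unfolding V[symmetric]
  proof (rule wiener_index_eq_half_sum)
    show "pair_graph (pentagonal_graph m n)"
      using n pair_graph_pentagonal_cylinder pair_graph_pentagonal_moebius by simp
  qed (simp_all only: V graph_dist_pentagonal[OF n] pentagonal_dist_self)
  also have "(\<Sum>u\<in>?V. \<Sum>v\<in>?V. real (pentagonal_dist m n u v)) =
      real (12 * n ^ 3 + 18 * n\<^sup>2 + 2 * n * (n\<^sup>2 div 4)) - real (4 * n * of_bool m)"
    unfolding sum_pentagonal_dist[of m n, symmetric] by simp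
  finally show ?thesis by (simp add: field_simps)
qed

theorem theorem3:
  fixes n :: nat
  assumes "n \<ge> 2"
  shows "wiener_index (pentagonal_cylinder n) =
           ereal (if even n then 25 / 4 * real n ^ 3 + 9 * real n ^ 2
                  else 25 / 4 * real n ^ 3 + 9 * real n ^ 2 - real n / 4)
       \<and> wiener_index (pentagonal_moebius n) =
           ereal (if even n then 25 / 4 * real n ^ 3 + 9 * real n ^ 2 - 2 * real n
                  else 25 / 4 * real n ^ 3 + 9 * real n ^ 2 - 9 * real n / 4)"
  using wiener_index_pentagonal[OF assms, of False, unfolded real_square_div_4]
    wiener_index_pentagonal[OF assms, of True, unfolded real_square_div_4]
  by (simp add: power2_eq_square power3_eq_cube field_simps)

end
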